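(* For every integer $n\ge 3$ and every integer $s\ge 2$, the maximum value of the sequence $\{S_s(n,k)\}_{k=1}^{n}$ of Stirling numbers of the first kind with level $s$ is given by $$S_s(n,2)=\bigl((n-1)!\bigr)^s\,H_{n-1}^{(s)}.$$
   Context: For a positive integer $s$, the Stirling numbers of the first kind with level $s$, written $S_s(n,k)$, are defined for integers $0\le k\le n$ by the polynomial identity $$\prod_{i=0}^{n-1}(x+i^s)=\sum_{k=0}^{n}S_s(n,k)\,x^k,\qquad n\ge 0.$$ The generalized harmonic numbers of order $s$ are $H_m^{(s)}=\sum_{\ell=1}^{m}\frac{1}{\ell^s}$ for $m\geq 1$. *)

theory Defs
  imports Complex_Main "HOL-Computational_Algebra.Polynomial" "HOL-Combinatorics.Stirling"
begin

text \<open>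
  The linear factor \<open>[:i ^ s, 1:]\<close> is the polynomial \<open>x + i ^ s\<close>. The notion is meant for
  \<open>s > 0\<close>, where the factor for \<open>i = 0\<close> is \<open>x\<close>; for \<open>s = 0\<close> it would be \<open>x + 1\<close>.
\<close>

definition stirling_level :: "nat \<Rightarrow> nat \<Rightarrow> nat \<Rightarrow> nat" where
  "stirling_level s n k = coeff (\<Prod>i<n. [:i ^ s, 1:]) k"

definition gen_harm :: "nat \<Rightarrow> nat \<Rightarrow> real" where
  "gen_harm s m = (\<Sum>l=1..m. 1 / real l ^ s)"

lemma stirling_level_0: "stirling_level s 0 k = (if k = 0 then 1 else 0)"
  by (simp add: stirling_level_def)

lemma stirling_level_Suc:
  "stirling_level s (Suc n) k =
     n ^ s * stirling_level s n k + (if k = 0 then 0 else stirling_level s n (k - 1))"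
  by (cases k) (simp_all add: stirling_level_def mult.commute[of _ "[:_, 1:]"])

lemma stirling_level_eq_0: "n < k \<Longrightarrow> stirling_level s n k = 0"
  by (induction n arbitrary: k) (auto simp: stirling_level_0 stirling_level_Suc)

text \<open>The generating polynomial identity, over any commutative semiring.\<close>

lemma prod_eq_sum_stirling_level:
  fixes x :: "'a::comm_semiring_1"
  shows "(\<Prod>i<n. x + of_nat i ^ s) = (\<Sum>k\<le>n. of_nat (stirling_level s n k) * x ^ k)"
proof (induction n)
  case 0
  show ?case by (simp add: stirling_level_0)
next
  case (Suc n)
  let ?S = "\<lambda>k. of_nat (stirling_level s n k) :: 'a"
  have "(\<Sum>k\<le>Suc n. of_nat (stirling_level s (Suc n) k) * x ^ k) =
        (\<Sum>k\<le>Suc n. of_nat n ^ s * (?S k * x ^ k)) +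
        (\<Sum>k\<le>Suc n. (if k = 0 then 0 else ?S (k - 1)) * x ^ k)"
    by (simp only: sum.distrib[symmetric])
       (intro sum.cong, auto simp: stirling_level_Suc algebra_simps)
  also have "(\<Sum>k\<le>Suc n. of_nat n ^ s * (?S k * x ^ k)) =
             of_nat n ^ s * (\<Sum>k\<le>n. ?S k * x ^ k)"
    by (simp add: sum_distrib_left stirling_level_eq_0)
  also have "(\<Sum>k\<le>Suc n. (if k = 0 then 0 else ?S (k - 1)) * x ^ k) =
             x * (\<Sum>k\<le>n. ?S k * x ^ k)"
    by (simp only: sum.atMost_Suc_shift) (simp add: sum_distrib_left algebra_simps)
  finally show ?case
    using Suc.IH by (simp add: algebra_simps)
qed

lemma stirling_level_1: "stirling_level 1 n k = stirling n k"
proof (induction n arbitrary: k)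
  case 0
  show ?case by (cases k) (simp_all add: stirling_level_0)
next
  case (Suc n)
  have "n * stirling n 0 = 0" by (cases n) simp_all
  then show ?case by (cases k) (simp_all add: stirling_level_Suc Suc.IH[simplified])
qed

end

theory Submission
  imports Defs
begin

text \<open>
  Up to the factor \<open>((n - 1)!) ^ s\<close>, the number \<open>S s n (k + 1)\<close> is the elementary symmetric function
  \<open>e k\<close> of the reciprocals \<open>1 / i ^ s\<close> for \<open>0 < i < n\<close>. Here \<open>1 \<le> e 1 \<le> 2\<close>, the upper bound being the
  telescoping estimate for \<open>\<Sum> 1 / i ^ 2\<close>, and \<open>2 * e 2 \<le> (e 1) ^ 2\<close>. Hence \<open>e 0 \<le> e 1\<close> and
  \<open>e 2 \<le> e 1\<close>, and the recurrence propagates the decrease to all larger \<open>k\<close>.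
\<close>

lemma stirling_level_Suc_0:
  assumes "s > 0"
  shows "stirling_level s (Suc m) 0 = 0"
  using assms by (induction m) (simp_all add: stirling_level_Suc)

lemma stirling_level_Suc_1:
  assumes "s > 0"
  shows "stirling_level s (Suc m) 1 = fact m ^ s"
proof (induction m)
  case 0
  show ?case by (simp add: stirling_level_Suc stirling_level_0)
next
  case (Suc m)
  have "stirling_level s (Suc (Suc m)) 1 = Suc m ^ s * stirling_level s (Suc m) 1"
    by (subst stirling_level_Suc) (simp add: stirling_level_Suc_0[OF assms])
  then show ?case
    using Suc.IH by (simp only: fact_Suc power_mult_distrib of_nat_id)
qed

lemma stirling_level_Suc_2:
  assumes "s > 0"
  shows "real (stirling_level s (Suc m) 2) = fact m ^ s * gen_harm s m"
proof (induction m)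
  case 0
  show ?case by (simp add: stirling_level_eq_0 gen_harm_def)
next
  case (Suc m)
  have "stirling_level s (Suc (Suc m)) 2 = Suc m ^ s * stirling_level s (Suc m) 2 + fact m ^ s"
    by (subst stirling_level_Suc) (simp add: stirling_level_Suc_1[OF assms, simplified])
  then have "real (stirling_level s (Suc (Suc m)) 2)
      = real (Suc m) ^ s * (fact m ^ s * gen_harm s m) + fact m ^ s"
    using Suc.IH by simp
  \<comment> \<open>The added \<open>fact m ^ s\<close> is \<open>fact (Suc m) ^ s\<close> times the
    new harmonic term.\<close>
  also have "\<dots> = (real (Suc m) * fact m) ^ s * (gen_harm s m + 1 / real (Suc m) ^ s)"
    by (simp add: power_mult_distrib distrib_left del: of_nat_Suc)
  also have "\<dots> = fact (Suc m) ^ s * gen_harm s (Suc m)"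
    by (simp add: gen_harm_def)
  finally show ?case .
qed

lemma gen_harm_ge_1:
  assumes "m > 0"
  shows "gen_harm s m \<ge> 1"
proof -
  have "(\<Sum>l\<in>{1}. 1 / real l ^ s) \<le> gen_harm s m"
    unfolding gen_harm_def using assms by (intro sum_mono2) auto
  then show ?thesis by simp
qed

text \<open>Subtracting \<open>1 / real (Suc m)\<close> from 2 makes the bound inductive: each new
  term is at most 1/(k(k+1)) = 1/k - 1/(k+1) with k = \<open>Suc m\<close>.\<close>

lemma gen_harm_le:
  assumes "s \<ge> 2"
  shows "gen_harm s (Suc m) \<le> 2 - 1 / real (Suc m)"
proof (induction m)
  case 0
  show ?case by (simp add: gen_harm_def)
next
  case (Suc m)
  have "1 / real (Suc (Suc m)) ^ s \<le> 1 / real (Suc (Suc m)) ^ 2"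
    using assms by (intro divide_left_mono power_increasing) auto
  also have "\<dots> \<le> 1 / real (Suc m) - 1 / real (Suc (Suc m))"
    by (simp add: divide_simps power2_eq_square)
  finally show ?case
    using Suc.IH by (simp add: gen_harm_def)
qed

lemma stirling_level_2_le:
  assumes "s \<ge> 2"
  shows "stirling_level s (Suc m) 2 \<le> 2 * stirling_level s (Suc m) 1"
proof -
  have "gen_harm s m \<le> 2"
  proof (cases m)
    case 0
    then show ?thesis by (simp add: gen_harm_def)
  next
    case (Suc k)
    have "0 \<le> 1 / real (Suc k)" by simp
    then show ?thesis using gen_harm_le[OF assms, of k] unfolding Suc by linarith
  qed
  then have "fact m ^ s * gen_harm s m \<le> fact m ^ s * 2"
    by (intro mult_left_mono) auto
  then have "real (stirling_level s (Suc m) 2) \<le> real (2 * stirling_level s (Suc m) 1)"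
    using assms by (simp add: stirling_level_Suc_1[simplified] stirling_level_Suc_2)
  then show ?thesis by linarith
qed

text \<open>This is 2 * e 2 \<le> (e 1) ^ 2 cleared of denominators, so that it stays in the
  naturals and the recurrence gives an induction.\<close>

lemma stirling_level_newton:
  assumes "s > 0"
  shows "2 * stirling_level s (Suc m) 1 * stirling_level s (Suc m) 3 \<le> stirling_level s (Suc m) 2 ^ 2"
proof (induction m)
  case 0
  show ?case by (simp add: stirling_level_eq_0)
next
  case (Suc m)
  define a where "a = Suc m ^ s"
  let ?S = "stirling_level s (Suc m)"
  have S: "stirling_level s (Suc (Suc m)) 1 = a * ?S 1"
    "stirling_level s (Suc (Suc m)) 2 = a * ?S 2 + ?S 1"
    "stirling_level s (Suc (Suc m)) 3 = a * ?S 3 + ?S 2"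
    by (subst stirling_level_Suc, simp add: a_def stirling_level_Suc_0[OF assms])+
  have "2 * (a * ?S 1) * (a * ?S 3 + ?S 2) = a ^ 2 * (2 * ?S 1 * ?S 3) + 2 * a * ?S 1 * ?S 2"
    by (simp add: algebra_simps power2_eq_square)
  \<comment> \<open>The induction hypothesis is scaled by \<open>a ^ 2\<close>; the extra
    \<open>?S 1 ^ 2\<close> completes the square.\<close>
  also have "\<dots> \<le> a ^ 2 * ?S 2 ^ 2 + 2 * a * ?S 1 * ?S 2 + ?S 1 ^ 2"
    using mult_left_mono[OF Suc.IH, of "a ^ 2"] by linarith
  also have "\<dots> = (a * ?S 2 + ?S 1) ^ 2"
    by (simp add: algebra_simps power2_eq_square)
  finally show ?case unfolding S .
qed

lemma stirling_level_3_le: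
  assumes "s \<ge> 2"
  shows "stirling_level s (Suc m) 3 \<le> stirling_level s (Suc m) 2"
proof -
  let ?S = "stirling_level s (Suc m)"
  have "2 * ?S 1 * ?S 3 \<le> ?S 2 * ?S 2"
    using stirling_level_newton[of s m] assms by (simp add: power2_eq_square)
  also have "\<dots> \<le> 2 * ?S 1 * ?S 2"
    using stirling_level_2_le[OF assms] by (rule mult_right_mono) simp
  \<comment> \<open>The common factor \<open>2 * ?S 1\<close> cancels because
    \<open>?S 1 = fact m ^ s\<close> is positive.\<close>
  finally show ?thesis
    using assms by (simp add: stirling_level_Suc_1[simplified])
qed

text \<open>For k > 2 the recurrence reduces the claim to the previous row at k and k - 1. For k = 2
  this would need the entry at 2 to be at most the entry at 1, which fails in general, so that case
  rests on \<open>stirling_level_3_le\<close>.\<close>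

lemma stirling_level_Suc_le:
  assumes "s \<ge> 2" and "k \<ge> 2"
  shows "stirling_level s (Suc m) (Suc k) \<le> stirling_level s (Suc m) k"
  using assms(2)
proof (induction m arbitrary: k)
  case 0
  then show ?case by (simp add: stirling_level_eq_0)
next
  case (Suc m)
  show ?case
  proof (cases "k = 2")
    case True
    then show ?thesis using stirling_level_3_le[OF assms(1), of "Suc m"] by simp
  next
    case False
    then obtain j where j: "k = Suc j" "j \<ge> 2"
      using Suc.prems by (cases k) auto
    show ?thesis
      unfolding stirling_level_Suc[of s "Suc m"]
      using j Suc.IH[of k] Suc.IH[of j] Suc.prems by (intro add_mono mult_left_mono) auto
  qed
qed

theorem corollary1:
  fixes n s :: nat
  assumes "n \<ge> 3" and "s \<ge> 2"
  shows "Max (stirling_level s n ` {1..n}) = stirling_level s n 2 \<and>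
         real (stirling_level s n 2) = fact (n - 1) ^ s * gen_harm s (n - 1)"
proof
  obtain m where n: "n = Suc m" and "m > 0"
    using assms(1) by (cases n) auto
  show S2: "real (stirling_level s n 2) = fact (n - 1) ^ s * gen_harm s (n - 1)"
    using stirling_level_Suc_2[of s m] assms(2) n by simp
  \<comment> \<open>The entry at 1 lies outside the decreasing range and is compared through the
    harmonic sum, which is at least 1.\<close>
  have "(fact m ^ s :: real) * 1 \<le> fact m ^ s * gen_harm s m"
    using gen_harm_ge_1[OF \<open>m > 0\<close>] by (intro mult_left_mono) auto
  then have "real (stirling_level s n 1) \<le> real (stirling_level s n 2)"
    using assms(2) n S2 by (simp add: stirling_level_Suc_1[simplified])
  then have le_1: "stirling_level s n 1 \<le> stirling_level s n 2"
    by simp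
  have le_k: "stirling_level s n k \<le> stirling_level s n 2" if "k \<ge> 2" for k
    using that
  proof (induction k rule: dec_induct)
    case (step k)
    then show ?case
      using stirling_level_Suc_le[OF assms(2), of k m] n by simp
  qed simp
  have "stirling_level s n k \<le> stirling_level s n 2" if "k \<ge> 1" for k
    using le_1 le_k that by (cases "k = 1") auto
  then show "Max (stirling_level s n ` {1..n}) = stirling_level s n 2"
    using assms(1) by (intro Max_eqI) auto
qed

end
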